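(* Let $D$ be a Dedekind domain, let $S$ be a nonempty subset of $D$, let $h\in\mathbb{N}\cup\{+\infty\}$ and $r\in\mathbb{N}$, and let $\mathcal{T}\subseteq\mathscr{I}(D)$, where $\mathscr{I}(D)$ is the set of all ideals of $D$. Then for positive integers $n<|S|$, the generalized-integer ideal $[n]_{S,\mathcal{T}}^{h,\{r\}}$ (a priori a fractional ideal of $D$) is an integral ideal of $D$.
   Context: $\mathbb{N}=\{0,1,2,\dots\}$. For an ideal $\mathfrak{b}$ of $D$, with $\mathfrak{b}^0=D$, put $v_{\mathfrak{b}}(a)=\sup\{k\in\mathbb{N}: aD\subseteq\mathfrak{b}^k\}\in\mathbb{N}\cup\{+\infty\}$ for $a\in D$. For a sequence $\mathbf{a}=(a_i)_{i=0}^\infty$ of elements of $S$ (repetitions allowed) define $$\alpha_n^{h,\{r\}}(S,\mathfrak{b},\mathbf{a})=\min_{A}\sum_{i\in A}\min\bigl(h,v_{\mathfrak{b}}(a_n-a_i)\bigr),$$ where $A$ ranges over all subsets of $\{0,\dots,n-1\}$ of cardinality $\max(n-r,0)$ (so the value is $0$ for $0\le n\le r$). The sequence $\mathbf{a}$ is an $r$-removed $\mathfrak{b}$-ordering of order $h$ of $S$ if $a_0,\dots,a_r\in S$ are arbitrary and, for every $n>r$, $a_n$ attains the minimum over $s\in S$ of $\min_{A}\sum_{i\in A}\min(h,v_{\mathfrak{b}}(s-a_i))$, $A$ ranging over subsets of $\{0,\dots,n-1\}$ of cardinality $n-r$. In a Dedekind domain, the numbers $\alpha_n^{h,\{r\}}(S,\mathfrak{b},\mathbf{a})$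 are the same for all $r$-removed $\mathfrak{b}$-orderings $\mathbf{a}$ of order $h$ of $S$; the common value is denoted $\alpha_n^{h,\{r\}}(S,\mathfrak{b})$. For $\mathcal{T}\subseteq\mathscr{I}(D)$ the $k$-th generalized factorial ideal is $$[k]!_{S,\mathcal{T}}^{h,\{r\}}=\prod_{\mathfrak{b}\in\mathcal{T}}\mathfrak{b}^{\alpha_k^{h,\{r\}}(S,\mathfrak{b})},$$ with conventions $\mathfrak{b}^0=(1)$ (including $(0)^0=(1)$), $\mathfrak{b}^{+\infty}=(0)$ for $\mathfrak{b}\neq(1)$, every power of $(1)$ equal to $(1)$, and the empty product equal to $(1)$. For $k<|S|$ only finitely many factors differ from the unit ideal $(1)=D$, and the product is a nonzero ideal. For positive integers $n<|S|$ the $n$-th generalized-integer ideal is the fractional ideal $$[n]_{S,\mathcal{T}}^{h,\{r\}}=\frac{[n]!_{S,\mathcal{T}}^{h,\{r\}}}{[n-1]!_{S,\mathcal{T}}^{h,\{r\}}}.$$ *)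

theory Defs
  imports "HOL-Algebra.Algebra" "HOL-Library.Extended_Nat"
begin

section \<open>Dedekind domains\<close>

text \<open>
  HOL-Algebra has no construction of the field of fractions. Instead, the domain \<open>D\<close> is taken to
  be a subring of a field \<open>K\<close> all of whose elements are fractions of elements of \<open>D\<close>.
\<close>

definition fraction_field :: "('a, 'm) ring_scheme \<Rightarrow> ('a, 'm) ring_scheme \<Rightarrow> bool" where
  "fraction_field D K \<longleftrightarrow>
     field K \<and> subring (carrier D) K \<and> D = K\<lparr>carrier := carrier D\<rparr> \<and>
     (\<forall>x\<in>carrier K. \<exists>a\<in>carrier D. \<exists>b\<in>carrier D - {\<zero>\<^bsub>D\<^esub>}. x = a \<otimes>\<^bsub>K\<^esub> inv\<^bsub>K\<^esub> b)"

definition integral_over :: "('a, 'm) ring_scheme \<Rightarrow> ('a, 'm) ring_scheme \<Rightarrow> 'a \<Rightarrow> bool" where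
  "integral_over D K x \<longleftrightarrow>
     (\<exists>p\<in>carrier ((carrier D)[X]\<^bsub>K\<^esub>). p \<noteq> [] \<and> lead_coeff p = \<one>\<^bsub>K\<^esub> \<and> ring.eval K p x = \<zero>\<^bsub>K\<^esub>)"

text \<open>With this definition a field counts as a Dedekind domain.\<close>

definition dedekind_domain :: "('a, 'm) ring_scheme \<Rightarrow> ('a, 'm) ring_scheme \<Rightarrow> bool" where
  "dedekind_domain D K \<longleftrightarrow>
     noetherian_domain D \<and> fraction_field D K \<and>
     (\<forall>x\<in>carrier K. integral_over D K x \<longrightarrow> x \<in> carrier D) \<and>
     (\<forall>P. primeideal P D \<and> P \<noteq> {\<zero>\<^bsub>D\<^esub>} \<longrightarrow> maximalideal P D)"


section \<open>Removed orderings and their invariants\<close>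

definition ideal_val :: "('a, 'm) ring_scheme \<Rightarrow> 'a set \<Rightarrow> 'a \<Rightarrow> enat" where
  "ideal_val D b x = Sup {enat k | k. PIdl\<^bsub>D\<^esub> x \<subseteq> b [^]\<^bsub>ideals_set D\<^esub> k}"

text \<open>
  Truncated subtraction makes \<open>n - r\<close> the number \<open>max (n - r) 0\<close>.
\<close>

definition removed_sum ::
    "('a, 'm) ring_scheme \<Rightarrow> enat \<Rightarrow> nat \<Rightarrow> 'a set \<Rightarrow> (nat \<Rightarrow> 'a) \<Rightarrow> nat \<Rightarrow> 'a \<Rightarrow> enat" where
  "removed_sum D h r b a n s =
     Min ((\<lambda>A. \<Sum>i\<in>A. min h (ideal_val D b (s \<ominus>\<^bsub>D\<^esub> a i))) ` {A. A \<subseteq> {..<n} \<and> card A = n - r})"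

definition alpha_seq ::
    "('a, 'm) ring_scheme \<Rightarrow> enat \<Rightarrow> nat \<Rightarrow> 'a set \<Rightarrow> (nat \<Rightarrow> 'a) \<Rightarrow> nat \<Rightarrow> enat" where
  "alpha_seq D h r b a n = removed_sum D h r b a n (a n)"

definition removed_ordering ::
    "('a, 'm) ring_scheme \<Rightarrow> enat \<Rightarrow> nat \<Rightarrow> 'a set \<Rightarrow> 'a set \<Rightarrow> (nat \<Rightarrow> 'a) \<Rightarrow> bool" where
  "removed_ordering D h r S b a \<longleftrightarrow>
     range a \<subseteq> S \<and> (\<forall>n>r. \<forall>s\<in>S. alpha_seq D h r b a n \<le> removed_sum D h r b a n s)"

text \<open>
  In a Dedekind domain the values \<open>alpha_seq D h r b a n\<close> agree for all orderings \<open>a\<close> of \<open>S\<close>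
  with respect to \<open>b\<close>, so the common value can be read off from any one of them. Such orderings
  exist when \<open>S\<close> is nonempty because \<open>enat\<close> is well-ordered.
\<close>

definition alpha ::
    "('a, 'm) ring_scheme \<Rightarrow> enat \<Rightarrow> nat \<Rightarrow> 'a set \<Rightarrow> 'a set \<Rightarrow> nat \<Rightarrow> enat" where
  "alpha D h r S b n = alpha_seq D h r b (SOME a. removed_ordering D h r S b a) n"


section \<open>Generalized factorial and integer ideals\<close>

definition ideal_epow :: "('a, 'm) ring_scheme \<Rightarrow> 'a set \<Rightarrow> enat \<Rightarrow> 'a set" where
  "ideal_epow D b e =
     (case e of enat k \<Rightarrow> b [^]\<^bsub>ideals_set D\<^esub> k
      | \<infinity> \<Rightarrow> if b = carrier D then carrier D else {\<zero>\<^bsub>D\<^esub>})"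

text \<open>
  \<open>finprod\<close> only makes sense on finite index sets, and \<open>T\<close> may be infinite; the index set is
  therefore cut down to the factors different from the unit ideal, which are finite in number
  when \<open>k < |S|\<close>.
\<close>

definition gen_factorial ::
    "('a, 'm) ring_scheme \<Rightarrow> enat \<Rightarrow> nat \<Rightarrow> 'a set \<Rightarrow> 'a set set \<Rightarrow> nat \<Rightarrow> 'a set" where
  "gen_factorial D h r S T k =
     finprod (ideals_set D) (\<lambda>b. ideal_epow D b (alpha D h r S b k))
       {b \<in> T. ideal_epow D b (alpha D h r S b k) \<noteq> carrier D}"

definition ideal_inverse :: "('a, 'm) ring_scheme \<Rightarrow> ('a, 'm) ring_scheme \<Rightarrow> 'a set \<Rightarrow> 'a set" where
  "ideal_inverse D K J = {x \<in> carrier K. \<forall>y\<in>J. x \<otimes>\<^bsub>K\<^esub> y \<in> carrier D}"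

text \<open>
  The quotient of \<open>I\<close> by \<open>J\<close> is the product of \<open>I\<close> with the inverse of \<open>J\<close>. The operator
  \<open>\<cdot>\<^bsub>K\<^esub>\<close> forms all finite sums of products in \<open>K\<close>, so on \<open>D\<close>-submodules of \<open>K\<close> it is the product
  of fractional ideals.
\<close>

definition gen_integer ::
    "('a, 'm) ring_scheme \<Rightarrow> ('a, 'm) ring_scheme \<Rightarrow> enat \<Rightarrow> nat \<Rightarrow> 'a set \<Rightarrow> 'a set set \<Rightarrow> nat \<Rightarrow> 'a set" where
  "gen_integer D K h r S T n =
     gen_factorial D h r S T n \<cdot>\<^bsub>K\<^esub> ideal_inverse D K (gen_factorial D h r S T (n - 1))"

end

theory Submission
  imports Defs
begin

text \<open>Write \<open>I\<^sub>k\<close> for the \<open>k\<close>-th generalized factorial. By the definition of the inverse,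
  \<open>J \<cdot> J\<^sup>-\<^sup>1 \<subseteq> D\<close> for every ideal \<open>J\<close>, so integrality of \<open>I\<^sub>n \<cdot> I\<^sub>n\<^sub>-\<^sub>1\<^sup>-\<^sup>1\<close> follows from
  \<open>I\<^sub>n \<subseteq> I\<^sub>n\<^sub>-\<^sub>1\<close> alone (\<open>quotient_ideal_integral\<close>), and this inclusion can be checked factor by factor:
  it is enough that the exponents do not decrease.

  They do not (\<open>alpha_mono_Suc\<close>). Both exponents are read off from one ordering \<open>a\<close>. Since \<open>a\<^sub>n\<^sub>-\<^sub>1\<close>
  minimizes the removed sum over the first \<open>n - 1\<close> entries, it does at least as well there as
  \<open>a\<^sub>n\<close>, and the removed sum of \<open>a\<^sub>n\<close> can only grow when one more entry is taken into account.

  The product is over the factors different from the unit ideal, and the factorwise comparison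
  needs them to be finite in number. Given \<open>n + 1\<close> distinct elements of \<open>S\<close>, an ideal \<open>b\<close> that contains
  none of their differences separates them, so by the pigeonhole principle one of them is
  incongruent modulo \<open>b\<close> to each of the first \<open>n\<close> entries of the ordering, and the exponent of \<open>b\<close> is zero
  (\<open>alpha_eq_0\<close>). Hence every nontrivial factor comes from an ideal containing one of finitely many
  nonzero elements, and in a Dedekind domain a nonzero element lies in only finitely many ideals
  (\<open>finite_ideals_containing\<close>).

  This last fact is proved without unique factorization, by noetherian induction on a nonzero ideal
  \<open>I\<close>. Only finitely many primes \<open>P\<close> contain \<open>I\<close>. For each of them there is an element \<open>y\<close> of the field of
  fractions, outside \<open>D\<close>, with \<open>yP \<subseteq> D\<close> and \<open>P + yP = D\<close>. The map \<open>J \<mapsto> J + yJ\<close>, which is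
  multiplication by the inverse of \<open>P\<close>, is injective on ideals \<open>J \<subseteq> P\<close> and sends those above \<open>I\<close> to
  ideals above \<open>I + yI\<close>. Integral closedness makes \<open>I + yI\<close> strictly larger than \<open>I\<close>, so the
  induction hypothesis applies.\<close>


section \<open>Noetherian rings\<close>

lemma (in noetherian_ring) exists_maximal_ideal_in_family:
  assumes "F \<noteq> {}" and "\<And>I. I \<in> F \<Longrightarrow> ideal I R"
  shows "\<exists>M\<in>F. \<forall>I\<in>F. M \<subseteq> I \<longrightarrow> I = M"
proof (rule subset_Zorn_nonempty[OF assms(1)])
  fix C assume C: "C \<noteq> {}" "subset.chain F C"
  then have "subset.chain {I. ideal I R} C"
    using assms(2) by (auto simp: subset_chain_def)
  then have "\<Union>C \<in> C"
    using C(1) ideal_chain_is_trivial by blast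
  then show "\<Union>C \<in> F"
    using C(2) by (auto simp: subset_chain_def)
qed

lemma (in noetherian_ring) ideal_induct [consumes 1, case_names step]:
  assumes "ideal I R"
    and "\<And>I. ideal I R \<Longrightarrow> (\<And>J. ideal J R \<Longrightarrow> I \<subset> J \<Longrightarrow> Q J) \<Longrightarrow> Q I"
  shows "Q I"
proof (rule ccontr)
  assume "\<not> Q I"
  then have "{J. ideal J R \<and> \<not> Q J} \<noteq> {}"
    using assms(1) by blast
  then have "\<exists>M\<in>{J. ideal J R \<and> \<not> Q J}. \<forall>J\<in>{J. ideal J R \<and> \<not> Q J}. M \<subseteq> J \<longrightarrow> J = M"
    by (rule exists_maximal_ideal_in_family) simp
  then obtain M where M: "ideal M R" "\<not> Q M"
    and max: "\<And>J. ideal J R \<Longrightarrow> \<not> Q J \<Longrightarrow> M \<subseteq> J \<Longrightarrow> J = M"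
    by auto
  have "Q M"
    by (rule assms(2)[OF M(1)]) (use max in blast)
  with M(2) show False ..
qed


section \<open>Finiteness of the set of ideals above a nonzero ideal\<close>

text \<open>The operations of \<open>D\<close> are those of \<open>K\<close>, so all computations take place in \<open>K\<close>, and \<open>R\<close> stands for
  the underlying set of \<open>D\<close>.\<close>

locale dedekind =
  fixes D :: "('a, 'm) ring_scheme" and K :: "('a, 'm) ring_scheme" (structure)
  assumes dedekind_domain: "dedekind_domain D K"

sublocale dedekind \<subseteq> K: field K
  using dedekind_domain by (simp add: dedekind_domain_def fraction_field_def)

sublocale dedekind \<subseteq> D: noetherian_domain D
  using dedekind_domain by (simp add: dedekind_domain_def)

context dedekind
begin

abbreviation (input) R :: "'a set" where "R \<equiv> carrier D"

lemma subring_R: "subring R K"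
  using dedekind_domain by (simp add: dedekind_domain_def fraction_field_def)

lemma D_eq: "D = K\<lparr>carrier := carrier D\<rparr>"
  using dedekind_domain by (simp add: dedekind_domain_def fraction_field_def)

lemma D_ops [simp]: "(\<otimes>\<^bsub>D\<^esub>) = (\<otimes>)" "(\<oplus>\<^bsub>D\<^esub>) = (\<oplus>)" "\<one>\<^bsub>D\<^esub> = \<one>" "\<zero>\<^bsub>D\<^esub> = \<zero>"
  by (subst D_eq, simp)+

lemma R_carrier: "x \<in> R \<Longrightarrow> x \<in> carrier K"
  using subringE(1)[OF subring_R] by blast

lemma R_closed:
  "\<zero> \<in> R" "\<one> \<in> R" "x \<in> R \<Longrightarrow> \<ominus> x \<in> R"
  "x \<in> R \<Longrightarrow> y \<in> R \<Longrightarrow> x \<oplus> y \<in> R" "x \<in> R \<Longrightarrow> y \<in> R \<Longrightarrow> x \<otimes> y \<in> R"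
  using subringE[OF subring_R] by auto

lemma integrally_closed: "x \<in> carrier K \<Longrightarrow> integral_over D K x \<Longrightarrow> x \<in> R"
  using dedekind_domain by (simp add: dedekind_domain_def)

lemma prime_maximal: "primeideal P D \<Longrightarrow> P \<noteq> {\<zero>} \<Longrightarrow> maximalideal P D"
  using dedekind_domain by (simp add: dedekind_domain_def)

text \<open>Closure under negation is absent from this criterion because it is multiplication by \<open>- 1\<close>.\<close>

lemma ideal_iff:
  "ideal I D \<longleftrightarrow> I \<subseteq> R \<and> \<zero> \<in> I \<and> (\<forall>x\<in>I. \<forall>y\<in>I. x \<oplus> y \<in> I) \<and> (\<forall>x\<in>I. \<forall>d\<in>R. d \<otimes> x \<in> I)"
  (is "_ \<longleftrightarrow> ?A")
proof
  assume "ideal I D"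
  then interpret ideal I D .
  show ?A
    using a_subset zero_closed a_closed I_l_closed by simp
next
  assume A: ?A
  show "ideal I D"
  proof (rule idealI[OF D.ring_axioms])
    show "subgroup I (add_monoid D)"
    proof (rule D.add.subgroupI)
      show "\<ominus>\<^bsub>D\<^esub> x \<in> I" if "x \<in> I" for x
      proof -
        have "\<ominus>\<^bsub>D\<^esub> x = (\<ominus>\<^bsub>D\<^esub> \<one>) \<otimes> x"
          using that A D.l_minus[of \<one> x] by (simp add: subset_iff R_closed R_carrier)
        then show ?thesis
          using that A D.a_inv_closed[OF D.one_closed] by simp
      qed
    qed (use A in auto)
    fix a x assume "a \<in> I" "x \<in> R"
    then show "x \<otimes>\<^bsub>D\<^esub> a \<in> I" "a \<otimes>\<^bsub>D\<^esub> x \<in> I"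
      using A K.m_comm[of a x] by (auto simp: subset_iff R_carrier)
  qed
qed

lemma idealD:
  assumes "ideal I D"
  shows "x \<in> I \<Longrightarrow> x \<in> R" "x \<in> I \<Longrightarrow> x \<in> carrier K" "\<zero> \<in> I"
    "x \<in> I \<Longrightarrow> y \<in> I \<Longrightarrow> x \<oplus> y \<in> I" "x \<in> I \<Longrightarrow> d \<in> R \<Longrightarrow> d \<otimes> x \<in> I"
  using assms R_carrier unfolding ideal_iff by blast+

lemma ideal_eq_R: "ideal I D \<Longrightarrow> \<one> \<in> I \<Longrightarrow> I = R"
  using ideal.one_imp_carrier[of I D] by simp

text \<open>The \<open>D\<close>-submodule of \<open>K\<close> generated by \<open>1, y, \<dots>, y\<^sup>n\<^sup>-\<^sup>1\<close>. Coefficient lists are of exact length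
  \<open>n\<close> and may start with zeros, which avoids degrees and normalization of polynomials.\<close>

definition pow_span :: "'a \<Rightarrow> nat \<Rightarrow> 'a set" where
  "pow_span y n = {K.eval q y | q. set q \<subseteq> R \<and> length q = n}"

lemma pow_span_0 [simp]: "pow_span y 0 = {\<zero>}"
  by (auto simp: pow_span_def)

lemma pow_span_Suc:
  "pow_span y (Suc n) = {d \<otimes> (y [^] n) \<oplus> m | d m. d \<in> R \<and> m \<in> pow_span y n}"
proof (intro equalityI subsetI)
  fix x assume "x \<in> pow_span y (Suc n)"
  then obtain q where q: "set q \<subseteq> R" "length q = Suc n" "x = K.eval q y"
    by (auto simp: pow_span_def)
  then obtain d q' where "q = d # q'" by (cases q) auto
  with q have "d \<in> R" "set q' \<subseteq> R" "length q' = n" "x = d \<otimes> (y [^] n) \<oplus> K.eval q' y"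
    by auto
  then show "x \<in> {d \<otimes> (y [^] n) \<oplus> m | d m. d \<in> R \<and> m \<in> pow_span y n}"
    unfolding pow_span_def by blast
next
  fix x assume "x \<in> {d \<otimes> (y [^] n) \<oplus> m | d m. d \<in> R \<and> m \<in> pow_span y n}"
  then obtain d q where q: "d \<in> R" "set q \<subseteq> R" "length q = n" "x = d \<otimes> (y [^] n) \<oplus> K.eval q y"
    unfolding pow_span_def by blast
  then have "x = K.eval (d # q) y" "set (d # q) \<subseteq> R" "length (d # q) = Suc n" by simp_all
  then show "x \<in> pow_span y (Suc n)"
    unfolding pow_span_def by blast
qed

lemma pow_span_module:
  assumes y: "y \<in> carrier K"
  shows "pow_span y n \<subseteq> carrier K" "\<zero> \<in> pow_span y n"
    "u \<in> pow_span y n \<Longrightarrow> v \<in> pow_span y n \<Longrightarrow> u \<oplus> v \<in> pow_span y n"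
    "u \<in> pow_span y n \<Longrightarrow> d \<in> R \<Longrightarrow> d \<otimes> u \<in> pow_span y n"
proof -
  have "pow_span y n \<subseteq> carrier K \<and> \<zero> \<in> pow_span y n \<and>
    (\<forall>u\<in>pow_span y n. \<forall>v\<in>pow_span y n. u \<oplus> v \<in> pow_span y n) \<and>
    (\<forall>u\<in>pow_span y n. \<forall>d\<in>R. d \<otimes> u \<in> pow_span y n)"
  proof (induction n)
    case 0
    then show ?case by (auto simp: R_carrier)
  next
    case (Suc n)
    have yn: "y [^] n \<in> carrier K" using y by simp
    have mK: "m \<in> carrier K" if "m \<in> pow_span y n" for m using that Suc by blast
    have 1: "(d \<otimes> (y [^] n) \<oplus> m) \<oplus> (e \<otimes> (y [^] n) \<oplus> k) = (d \<oplus> e) \<otimes> (y [^] n) \<oplus> (m \<oplus> k)"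
      if "d \<in> R" "e \<in> R" "m \<in> pow_span y n" "k \<in> pow_span y n" for d e m k
      using R_carrier[OF that(1)] R_carrier[OF that(2)] mK[OF that(3)] mK[OF that(4)] yn
      by algebra
    have 2: "e \<otimes> (d \<otimes> (y [^] n) \<oplus> m) = (e \<otimes> d) \<otimes> (y [^] n) \<oplus> e \<otimes> m"
      if "d \<in> R" "e \<in> R" "m \<in> pow_span y n" for d e m
      using R_carrier[OF that(1)] R_carrier[OF that(2)] mK[OF that(3)] yn by algebra
    have 3: "\<zero> = \<zero> \<otimes> (y [^] n) \<oplus> \<zero>" using yn by simp
    have A: "d \<otimes> (y [^] n) \<oplus> m \<in> pow_span y (Suc n)" if "d \<in> R" "m \<in> pow_span y n" for d m
      unfolding pow_span_Suc using that by blast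
    show ?case
    proof (intro conjI ballI)
      show "pow_span y (Suc n) \<subseteq> carrier K"
        unfolding pow_span_Suc using yn mK R_carrier by auto
      show "\<zero> \<in> pow_span y (Suc n)"
        using A[of \<zero> \<zero>] 3 Suc R_closed by simp
    next
      fix u v assume "u \<in> pow_span y (Suc n)" "v \<in> pow_span y (Suc n)"
      then obtain d m e k where "u = d \<otimes> (y [^] n) \<oplus> m" "v = e \<otimes> (y [^] n) \<oplus> k"
        "d \<in> R" "e \<in> R" "m \<in> pow_span y n" "k \<in> pow_span y n"
        unfolding pow_span_Suc by blast
      then show "u \<oplus> v \<in> pow_span y (Suc n)"
        using A[of "d \<oplus> e" "m \<oplus> k"] Suc R_closed(4) by (simp add: 1)
    next
      fix u e assume e: "e \<in> R" and "u \<in> pow_span y (Suc n)"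
      then obtain d m where "u = d \<otimes> (y [^] n) \<oplus> m" "d \<in> R" "m \<in> pow_span y n"
        unfolding pow_span_Suc by blast
      then show "e \<otimes> u \<in> pow_span y (Suc n)"
        using A[of "e \<otimes> d" "e \<otimes> m"] e Suc R_closed(5) by (simp add: 2)
    qed
  qed
  then show "pow_span y n \<subseteq> carrier K" "\<zero> \<in> pow_span y n"
    "u \<in> pow_span y n \<Longrightarrow> v \<in> pow_span y n \<Longrightarrow> u \<oplus> v \<in> pow_span y n"
    "u \<in> pow_span y n \<Longrightarrow> d \<in> R \<Longrightarrow> d \<otimes> u \<in> pow_span y n"
    by blast+
qed

lemma pow_span_mono:
  assumes "y \<in> carrier K" "m \<le> n"
  shows "pow_span y m \<subseteq> pow_span y n"
proof -
  have "pow_span y k \<subseteq> pow_span y (Suc k)" for k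
  proof
    fix x assume x: "x \<in> pow_span y k"
    then have "x = \<zero> \<otimes> (y [^] k) \<oplus> x"
      using pow_span_module(1)[OF assms(1), of k] assms(1) by auto
    then show "x \<in> pow_span y (Suc k)"
      unfolding pow_span_Suc using x R_closed(1) by blast
  qed
  then show ?thesis
    using lift_Suc_mono_le[of "pow_span y"] assms(2) by blast
qed

lemma pow_span_imp_integral:
  assumes y: "y \<in> carrier K" and "y [^] n \<in> pow_span y n"
  shows "integral_over D K y"
proof -
  have "\<ominus> (y [^] n) \<in> pow_span y n"
    using pow_span_module(4)[OF y assms(2), of "\<ominus> \<one>"] y R_closed by (simp add: K.l_minus)
  then obtain q where q: "set q \<subseteq> R" "length q = n" "\<ominus> (y [^] n) = K.eval q y"
    by (auto simp: pow_span_def)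
  have "K.eval (\<one> # q) y = \<zero>"
    using q y K.r_neg[of "y [^] n"] by simp
  moreover have "\<one> # q \<in> carrier (R[X]\<^bsub>K\<^esub>)"
    unfolding univ_poly_carrier[symmetric] polynomial_def using q R_closed by auto
  ultimately show ?thesis
    unfolding integral_over_def by (metis list.distinct(1) list.sel(1))
qed

text \<open>If \<open>yI \<subseteq> I\<close> and \<open>0 \<noteq> c \<in> I\<close>, then \<open>cy\<^sup>n \<in> I\<close> for all \<open>n\<close>. The sets \<open>M n = c \<cdot> pow_span y n\<close> are
  therefore an ascending chain of ideals of \<open>D\<close>. Where it stops, cancelling \<open>c\<close> expresses a power of \<open>y\<close> by
  lower ones, which is an equation of integral dependence. Ascending chains take the place of the
  usual determinant argument.\<close>

lemma stabilizer_of_ideal_integral: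
  assumes y: "y \<in> carrier K" and I: "ideal I D" "I \<noteq> {\<zero>}"
    and stable: "\<And>x. x \<in> I \<Longrightarrow> y \<otimes> x \<in> I"
  shows "y \<in> R"
proof -
  obtain c where c: "c \<in> I" "c \<noteq> \<zero>"
    using I idealD(3) by blast
  have cK: "c \<in> carrier K" using c I idealD by blast
  define M where "M n = (\<lambda>m. c \<otimes> m) ` pow_span y n" for n
  have pow: "c \<otimes> (y [^] n) \<in> I" for n :: nat
  proof (induction n)
    case (Suc n)
    have "c \<otimes> (y [^] Suc n) = y \<otimes> (c \<otimes> (y [^] n))"
      using y cK by (simp add: K.m_ac)
    then show ?case using Suc stable by simp
  qed (use c cK in simp)
  have sub: "M n \<subseteq> I" for n
  proof (induction n)
    case 0
    then show ?case using I cK idealD(3) by (simp add: M_def)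
  next
    case (Suc n)
    show ?case
    proof
      fix x assume "x \<in> M (Suc n)"
      then obtain d m where dm: "d \<in> R" "m \<in> pow_span y n" "x = c \<otimes> (d \<otimes> (y [^] n) \<oplus> m)"
        by (auto simp: M_def pow_span_Suc)
      then have mK: "m \<in> carrier K" "d \<in> carrier K"
        using pow_span_module(1)[OF y] R_carrier by auto
      have "x = d \<otimes> (c \<otimes> (y [^] n)) \<oplus> c \<otimes> m"
        using dm(3) mK y cK by (simp add: K.r_distr K.m_ac)
      moreover have "c \<otimes> m \<in> I" using Suc dm by (auto simp: M_def)
      ultimately show "x \<in> I" using pow[of n] dm idealD[OF I(1)] by simp
    qed
  qed
  have idl: "ideal (M n) D" for n
    unfolding ideal_iff
  proof (intro conjI ballI)
    show "M n \<subseteq> R" using sub I idealD(1) by blast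
    show "\<zero> \<in> M n"
      unfolding M_def by (rule image_eqI[of _ _ \<zero>]) (use cK pow_span_module(2)[OF y] in auto)
    show "u \<oplus> v \<in> M n" if "u \<in> M n" "v \<in> M n" for u v
    proof -
      obtain u' v' where "u = c \<otimes> u'" "v = c \<otimes> v'" "u' \<in> pow_span y n" "v' \<in> pow_span y n"
        using \<open>u \<in> M n\<close> \<open>v \<in> M n\<close> by (auto simp: M_def)
      moreover from this have "u \<oplus> v = c \<otimes> (u' \<oplus> v')"
        using pow_span_module(1)[OF y, of n] cK K.r_distr[of u' v' c] by (simp add: subset_iff)
      ultimately show ?thesis
        using pow_span_module(3)[OF y] by (auto simp: M_def)
    qed
    show "d \<otimes> u \<in> M n" if "u \<in> M n" "d \<in> R" for u d
    proof -
      obtain u' where "u = c \<otimes> u'" "u' \<in> pow_span y n"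
        using \<open>u \<in> M n\<close> by (auto simp: M_def)
      moreover from this have "d \<otimes> u = c \<otimes> (d \<otimes> u')"
        using pow_span_module(1)[OF y, of n] cK R_carrier[OF \<open>d \<in> R\<close>] K.m_lcomm[of d c u']
        by (simp add: subset_iff)
      ultimately show ?thesis
        using pow_span_module(4)[OF y] \<open>d \<in> R\<close> by (auto simp: M_def)
    qed
  qed
  obtain N where N: "\<And>n. M N \<subseteq> M n \<Longrightarrow> M n = M N"
    using D.exists_maximal_ideal_in_family[of "range M"] idl by auto
  have "M (Suc N) = M N"
    by (rule N) (use pow_span_mono[OF y, of N "Suc N"] in \<open>auto simp: M_def\<close>)
  moreover have "y [^] N \<in> pow_span y (Suc N)"
  proof -
    have "y [^] N = \<one> \<otimes> (y [^] N) \<oplus> \<zero>" using y by simp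
    then show ?thesis
      unfolding pow_span_Suc using R_closed(2) pow_span_module(2)[OF y] by blast
  qed
  ultimately have "c \<otimes> (y [^] N) \<in> M N" by (auto simp: M_def)
  then obtain m where m: "m \<in> pow_span y N" "c \<otimes> (y [^] N) = c \<otimes> m"
    by (auto simp: M_def)
  then have "y [^] N = m"
    using K.m_lcancel[of c "y [^] N" m] c cK y pow_span_module(1)[OF y] by auto
  then show ?thesis
    using m pow_span_imp_integral[OF y, of N] integrally_closed y by blast
qed

lemma proper_ideal_in_prime:
  assumes J: "ideal J D" "J \<noteq> R"
  obtains P where "primeideal P D" "J \<subseteq> P"
proof -
  let ?F = "{I. ideal I D \<and> J \<subseteq> I \<and> I \<noteq> R}"
  have "?F \<noteq> {}" using J by blast
  then have "\<exists>P\<in>?F. \<forall>I\<in>?F. P \<subseteq> I \<longrightarrow> I = P"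
    by (rule D.exists_maximal_ideal_in_family) simp
  then obtain P where P: "P \<in> ?F" "\<forall>I\<in>?F. P \<subseteq> I \<longrightarrow> I = P"
    by (elim bexE)
  have "maximalideal P D"
  proof (rule maximalidealI)
    fix I assume "ideal I D" "P \<subseteq> I" "I \<subseteq> R"
    then show "I = P \<or> I = R"
      using P by blast
  qed (use P in simp_all, use P in blast)
  then show ?thesis
    using that[of P] D.maximalideal_prime[of P] P(1) by simp
qed

lemma ideal_add_principal:
  assumes I: "ideal I D" and u: "u \<in> R"
  shows "ideal {x \<oplus> d \<otimes> u | x d. x \<in> I \<and> d \<in> R} D" (is "ideal ?J D")
    and "I \<subseteq> {x \<oplus> d \<otimes> u | x d. x \<in> I \<and> d \<in> R}"
    and "u \<in> {x \<oplus> d \<otimes> u | x d. x \<in> I \<and> d \<in> R}"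
proof -
  have uK: "u \<in> carrier K" using u R_carrier by blast
  note IK = idealD(2)[OF I]
  show "I \<subseteq> ?J"
  proof
    fix x assume "x \<in> I"
    moreover from this have "x = x \<oplus> \<zero> \<otimes> u" using uK IK by simp
    ultimately show "x \<in> ?J" using R_closed(1) by blast
  qed
  have "u = \<zero> \<oplus> \<one> \<otimes> u" using uK by simp
  then show "u \<in> ?J" using R_closed(2) idealD(3)[OF I] by blast
  show "ideal ?J D"
    unfolding ideal_iff
  proof (intro conjI ballI)
    show "?J \<subseteq> R" using R_closed u idealD(1)[OF I] by auto
    show "\<zero> \<in> ?J" using \<open>I \<subseteq> ?J\<close> idealD(3)[OF I] by blast
  next
    fix v w assume "v \<in> ?J" "w \<in> ?J"
    then obtain x d x' d' where 1: "v = x \<oplus> d \<otimes> u" "w = x' \<oplus> d' \<otimes> u" "x \<in> I" "x' \<in> I" "d \<in> R" "d' \<in> R"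
      by blast
    then have "v \<oplus> w = (x \<oplus> x') \<oplus> (d \<oplus> d') \<otimes> u"
      using IK[of x] IK[of x'] R_carrier[of d] R_carrier[of d'] uK by simp algebra
    then show "v \<oplus> w \<in> ?J" using 1 R_closed(4) idealD(4)[OF I] by blast
  next
    fix v e assume "v \<in> ?J" and e: "e \<in> R"
    then obtain x d where 1: "v = x \<oplus> d \<otimes> u" "x \<in> I" "d \<in> R"
      by blast
    then have "e \<otimes> v = e \<otimes> x \<oplus> (e \<otimes> d) \<otimes> u"
      using IK[of x] R_carrier[of d] R_carrier[of e] e uK by simp algebra
    then show "e \<otimes> v \<in> ?J" using 1 e R_closed(5) idealD(5)[OF I] by blast
  qed
qed

text \<open>If \<open>I\<close> is proper and not prime, say \<open>uv \<in> I\<close> with \<open>u, v \<notin> I\<close>, then every prime above \<open>I\<close> lies above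
  \<open>I + (u)\<close> or \<open>I + (v)\<close>, and both of these are larger. If \<open>I\<close> is prime, it is maximal.\<close>

lemma finite_primes_above:
  assumes "ideal I D" "I \<noteq> {\<zero>}"
  shows "finite {P. primeideal P D \<and> I \<subseteq> P}"
  using assms
proof (induction rule: D.ideal_induct)
  case (step I)
  note I = \<open>ideal I D\<close>
  consider "I = R" | "primeideal I D" | "I \<noteq> R" "\<not> primeideal I D" by blast
  then show ?case
  proof cases
    case 1
    then have "{P. primeideal P D \<and> I \<subseteq> P} = {}"
      using primeideal.I_notcarr idealD(1) primeideal.axioms(1) by blast
    then show ?thesis by (simp only: finite.emptyI)
  next
    case 2
    then have "maximalideal I D" using prime_maximal step.prems by blast
    have "P = I" if "primeideal P D" "I \<subseteq> P" for P
    proof -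
      have "ideal P D" "P \<noteq> R"
        using that(1) primeideal.axioms(1) primeideal.I_notcarr by blast+
      then show ?thesis
        using maximalideal.I_maximal[OF \<open>maximalideal I D\<close>, of P] that(2) idealD(1)[of P] by blast
    qed
    then have "{P. primeideal P D \<and> I \<subseteq> P} \<subseteq> {I}"
      by blast
    then show ?thesis by (rule finite_subset) simp
  next
    case 3
    then obtain u v where uv: "u \<in> R" "v \<in> R" "u \<otimes> v \<in> I" "u \<notin> I" "v \<notin> I"
      using ideal.primeidealCE[OF I D.is_cring 3(2)] 3(1) by (metis D_ops(1))
    define J where "J w = {x \<oplus> d \<otimes> w | x d. x \<in> I \<and> d \<in> R}" for w
    have fin: "finite {P. primeideal P D \<and> J w \<subseteq> P}" if "w \<in> R" "w \<notin> I" for w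
    proof (rule step.IH)
      show "ideal (J w) D" "I \<subset> J w"
        unfolding J_def using ideal_add_principal[OF I \<open>w \<in> R\<close>] \<open>w \<notin> I\<close> by blast+
      then show "J w \<noteq> {\<zero>}" using step.prems idealD(3)[OF I] by blast
    qed
    have "J w \<subseteq> P" if "primeideal P D" "I \<subseteq> P" "w \<in> P" for w P
      unfolding J_def using that idealD(4,5)[OF primeideal.axioms(1)[OF that(1)]] by blast
    moreover have "u \<in> P \<or> v \<in> P" if "primeideal P D" "I \<subseteq> P" for P
      using primeideal.I_prime[OF that(1), of u v] uv that by auto
    ultimately have "{P. primeideal P D \<and> I \<subseteq> P}
        \<subseteq> {P. primeideal P D \<and> J u \<subseteq> P} \<union> {P. primeideal P D \<and> J v \<subseteq> P}"
      by blast
    then show ?thesis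
      using fin[of u] fin[of v] uv finite_subset by blast
  qed
qed

text \<open>Among the colon ideals \<open>C b = ((a) : b)\<close> contained in \<open>P\<close>, a maximal one is prime, hence a maximal
  ideal and equal to \<open>P\<close>. The set is nonempty because \<open>C 1 = (a) \<subseteq> P\<close>. For primality the key
  point is that \<open>wx \<in> C b\<close> with \<open>w \<notin> P\<close> implies \<open>x \<in> C b\<close>: the ideal \<open>C (wb)\<close> is again contained in \<open>P\<close>, so
  it equals \<open>C b\<close> by maximality.\<close>

lemma nonzero_prime_eq_colon:
  assumes P: "primeideal P D" and a: "a \<in> P" "a \<noteq> \<zero>"
  obtains b where "b \<in> R" "P = {x \<in> R. \<exists>d\<in>R. b \<otimes> x = a \<otimes> d}" 
proof -
  have Pi: "ideal P D" using P primeideal.axioms(1) by blast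
  have prime: "x \<in> P \<or> z \<in> P" if "x \<in> R" "z \<in> R" "x \<otimes> z \<in> P" for x z
    using primeideal.I_prime[OF P, of x z] that by auto
  have aR: "a \<in> R" using a Pi idealD by blast
  have aK: "a \<in> carrier K" using aR R_carrier by blast
  define C where "C b = {x \<in> R. \<exists>d\<in>R. b \<otimes> x = a \<otimes> d}" for b
  have CI: "x \<in> C b" if "x \<in> R" "d \<in> R" "b \<otimes> x = a \<otimes> d" for x d b
    using that by (auto simp: C_def)
  have C_ideal: "ideal (C b) D" if b: "b \<in> R" for b
    unfolding ideal_iff
  proof (intro conjI ballI)
    have bK: "b \<in> carrier K" using b R_carrier by blast
    show "C b \<subseteq> R" by (auto simp: C_def)
    show "\<zero> \<in> C b" using CI[of \<zero> \<zero>] R_closed(1) aK bK by simp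
    show "u \<oplus> v \<in> C b" if "u \<in> C b" "v \<in> C b" for u v
    proof -
      obtain d e where de: "u \<in> R" "v \<in> R" "d \<in> R" "e \<in> R" "b \<otimes> u = a \<otimes> d" "b \<otimes> v = a \<otimes> e"
        using \<open>u \<in> C b\<close> \<open>v \<in> C b\<close> by (auto simp: C_def)
      then have "b \<otimes> (u \<oplus> v) = a \<otimes> (d \<oplus> e)"
        using aK bK by (simp add: K.r_distr R_carrier)
      then show ?thesis using CI de R_closed(4) by blast
    qed
    show "c \<otimes> u \<in> C b" if "u \<in> C b" "c \<in> R" for u c
    proof -
      obtain d where d: "u \<in> R" "d \<in> R" "b \<otimes> u = a \<otimes> d"
        using \<open>u \<in> C b\<close> by (auto simp: C_def)
      have "b \<otimes> (c \<otimes> u) = c \<otimes> (b \<otimes> u)" "a \<otimes> (c \<otimes> d) = c \<otimes> (a \<otimes> d)"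
        using d(1,2) aK bK \<open>c \<in> R\<close> by (simp_all add: K.m_lcomm R_carrier)
      then have "b \<otimes> (c \<otimes> u) = a \<otimes> (c \<otimes> d)" using d(3) by simp
      then show ?thesis using CI d \<open>c \<in> R\<close> R_closed(5) by blast
    qed
  qed
  have C_mult: "C b \<subseteq> C (w \<otimes> b)" if "b \<in> R" "w \<in> R" for b w
  proof
    fix x assume "x \<in> C b"
    then obtain d where d: "x \<in> R" "d \<in> R" "b \<otimes> x = a \<otimes> d" by (auto simp: C_def)
    then have "(w \<otimes> b) \<otimes> x = a \<otimes> (w \<otimes> d)"
      using aK that by (simp add: K.m_lcomm K.m_assoc R_carrier)
    then show "x \<in> C (w \<otimes> b)" using CI d that R_closed(5) by blast
  qed
  have C_mult_iff: "x \<in> C (w \<otimes> b) \<longleftrightarrow> w \<otimes> x \<in> C b" if "b \<in> R" "w \<in> R" "x \<in> R" for b w x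
    unfolding C_def using that R_closed(5) R_carrier[OF that(1)] R_carrier[OF that(2)] R_carrier[OF that(3)]
    by (auto simp: K.m_ac)
  let ?F = "{C b | b. b \<in> R \<and> C b \<subseteq> P}"
  have "C \<one> \<subseteq> P"
  proof
    fix x assume "x \<in> C \<one>"
    then obtain d where "x \<in> R" "d \<in> R" "x = a \<otimes> d" by (auto simp: C_def R_carrier)
    then show "x \<in> P" using idealD(5)[OF Pi a(1), of d] K.m_comm[of a d] aK R_carrier by simp
  qed
  then have "?F \<noteq> {}" using R_closed(2) by blast
  have "\<exists>M\<in>?F. \<forall>I\<in>?F. M \<subseteq> I \<longrightarrow> I = M"
    by (rule D.exists_maximal_ideal_in_family) (use \<open>?F \<noteq> {}\<close> C_ideal in auto)
  then obtain M where M: "M \<in> ?F" "\<forall>I\<in>?F. M \<subseteq> I \<longrightarrow> I = M"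
    by (elim bexE)
  from M(1) obtain b where b: "b \<in> R" "C b \<subseteq> P" and "M = C b"
    by blast
  then have max: "C b' = C b" if "b' \<in> R" "C b' \<subseteq> P" "C b \<subseteq> C b'" for b'
    using M(2) that by blast
  have outside: "x \<in> C b" if "w \<in> R" "w \<notin> P" "x \<in> R" "w \<otimes> x \<in> C b" for w x
  proof -
    have "C (w \<otimes> b) \<subseteq> P"
    proof
      fix z assume z: "z \<in> C (w \<otimes> b)"
      then have zR: "z \<in> R" by (simp add: C_def)
      then have "w \<otimes> z \<in> P" using z C_mult_iff[OF b(1) that(1) zR] b(2) by blast
      then show "z \<in> P" using prime[OF that(1) zR] that(2) by blast
    qed
    then have "C (w \<otimes> b) = C b"
      using max[of "w \<otimes> b"] C_mult[OF b(1) that(1)] R_closed(5)[OF that(1) b(1)] by simp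
    then show ?thesis using C_mult_iff[OF b(1) that(1,3)] that(4) by simp
  qed
  have "primeideal (C b) D"
  proof (rule primeidealI[OF C_ideal[OF b(1)] D.is_cring])
    show "R \<noteq> C b"
      using b(2) primeideal.I_notcarr[OF P] idealD(1)[OF Pi] by blast
    fix u v assume uv: "u \<in> R" "v \<in> R" "u \<otimes>\<^bsub>D\<^esub> v \<in> C b"
    then have uv': "u \<otimes> v \<in> C b" by simp
    show "u \<in> C b \<or> v \<in> C b"
    proof (cases "C (u \<otimes> b) \<subseteq> P")
      case True
      then have "C (u \<otimes> b) = C b"
        using max[of "u \<otimes> b"] C_mult[OF b(1) uv(1)] R_closed(5)[OF uv(1) b(1)] by simp
      then show ?thesis using C_mult_iff[OF b(1) uv(1,2)] uv' by simp
    next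
      case False
      then obtain w where w: "w \<in> C (u \<otimes> b)" "w \<notin> P" by blast
      then have wR: "w \<in> R" by (simp add: C_def)
      then have "w \<otimes> u \<in> C b"
        using C_mult_iff[OF b(1) uv(1) wR] w(1) K.m_comm[of u w] R_carrier uv(1) wR by simp
      then show ?thesis using outside[OF wR w(2) uv(1)] by blast
    qed
  qed
  moreover have "a \<in> C b"
    using CI[of a b b] aR b K.m_comm[of b a] R_carrier by simp
  ultimately have "maximalideal (C b) D" using prime_maximal a by blast
  then have "P = C b"
    using maximalideal.I_maximal[of "C b" D P] Pi b(2) idealD(1)[OF Pi] primeideal.I_notcarr[OF P]
    by blast
  then show ?thesis using that b unfolding C_def by blast
qed

text \<open>The ideal \<open>J + yJ\<close> is the product of \<open>J\<close> with the fractional ideal generated by \<open>1\<close> and \<open>y\<close>.\<close>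

lemma scaled_sum_ideal:
  assumes J: "ideal J D" and y: "y \<in> carrier K" and yJ: "\<And>x. x \<in> J \<Longrightarrow> y \<otimes> x \<in> R"
  shows "ideal {u \<oplus> y \<otimes> v | u v. u \<in> J \<and> v \<in> J} D" (is "ideal ?Q D")
    and "J \<subseteq> {u \<oplus> y \<otimes> v | u v. u \<in> J \<and> v \<in> J}"
    and "x \<in> J \<Longrightarrow> y \<otimes> x \<in> {u \<oplus> y \<otimes> v | u v. u \<in> J \<and> v \<in> J}"
proof -
  note JK = idealD(2)[OF J]
  show sub: "J \<subseteq> ?Q"
  proof
    fix x assume "x \<in> J"
    moreover from this have "x = x \<oplus> y \<otimes> \<zero>" using y JK by simp
    ultimately show "x \<in> ?Q" using idealD(3)[OF J] by blast
  qed
  show "y \<otimes> x \<in> ?Q" if "x \<in> J"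
  proof -
    have "y \<otimes> x = \<zero> \<oplus> y \<otimes> x" using that y JK by simp
    then show ?thesis using that idealD(3)[OF J] by blast
  qed
  show "ideal ?Q D"
    unfolding ideal_iff
  proof (intro conjI ballI)
    show "?Q \<subseteq> R" using R_closed(4) yJ idealD(1)[OF J] by auto
    show "\<zero> \<in> ?Q" using sub idealD(3)[OF J] by blast
  next
    fix v w assume "v \<in> ?Q" "w \<in> ?Q"
    then obtain a b a' b' where 1: "v = a \<oplus> y \<otimes> b" "w = a' \<oplus> y \<otimes> b'"
      "a \<in> J" "a' \<in> J" "b \<in> J" "b' \<in> J"
      by blast
    then have "v \<oplus> w = (a \<oplus> a') \<oplus> y \<otimes> (b \<oplus> b')"
      using JK[of a] JK[of a'] JK[of b] JK[of b'] y by simp algebra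
    then show "v \<oplus> w \<in> ?Q" using 1 idealD(4)[OF J] by blast
  next
    fix v e assume "v \<in> ?Q" and e: "e \<in> R"
    then obtain a b where 1: "v = a \<oplus> y \<otimes> b" "a \<in> J" "b \<in> J"
      by blast
    then have "e \<otimes> v = e \<otimes> a \<oplus> y \<otimes> (e \<otimes> b)"
      using JK[of a] JK[of b] R_carrier[OF e] y by simp algebra
    then show "e \<otimes> v \<in> ?Q" using 1 e idealD(5)[OF J] by blast
  qed
qed

text \<open>Write \<open>P = ((a) : b)\<close> and put \<open>y = b/a\<close>. Then \<open>yP \<subseteq> D\<close>, and \<open>y \<notin> D\<close> because \<open>1 \<notin> P\<close>. The ideal
  \<open>P + yP\<close> contains the maximal ideal \<open>P\<close>. It is not \<open>P\<close> itself, for otherwise \<open>y\<close> would be integral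
  over \<open>D\<close>. So it is \<open>D\<close>, and \<open>1\<close> has the stated form.\<close>

lemma prime_invertible:
  assumes P: "primeideal P D" and "P \<noteq> {\<zero>}"
  obtains y p q where "y \<in> carrier K" "y \<notin> R" "\<And>x. x \<in> P \<Longrightarrow> y \<otimes> x \<in> R"
    "p \<in> P" "q \<in> P" "p \<oplus> y \<otimes> q = \<one>"
proof -
  have Pi: "ideal P D" using P primeideal.axioms(1) by blast
  obtain a where a: "a \<in> P" "a \<noteq> \<zero>" using assms idealD(3)[OF Pi] by blast
  then have aK: "a \<in> carrier K" using idealD(2)[OF Pi] by blast
  then have inv: "inv a \<in> carrier K" "inv a \<otimes> a = \<one>"
    using a K.field_Units by (auto intro: K.Units_l_inv K.Units_inv_closed)
  obtain b where b: "b \<in> R" "P = {x \<in> R. \<exists>d\<in>R. b \<otimes> x = a \<otimes> d}"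
    using nonzero_prime_eq_colon[OF P a] by blast
  have bK: "b \<in> carrier K" using b R_carrier by blast
  define y where "y = inv a \<otimes> b"
  have yK: "y \<in> carrier K" using inv bK by (simp add: y_def)
  have ay: "a \<otimes> y = b"
    using inv aK bK K.m_comm[of a "inv a"] by (simp add: y_def K.m_assoc[symmetric])
  have yR: "y \<notin> R"
  proof
    assume "y \<in> R"
    then have "\<one> \<in> P" using b ay bK R_closed(2) by auto
    then show False using ideal_eq_R[OF Pi] primeideal.I_notcarr[OF P] by blast
  qed
  have yP: "y \<otimes> x \<in> R" if "x \<in> P" for x
  proof -
    obtain d where d: "x \<in> R" "d \<in> R" "b \<otimes> x = a \<otimes> d" using \<open>x \<in> P\<close> b by blast
    have "y \<otimes> x = inv a \<otimes> (b \<otimes> x)"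
      using d inv bK R_carrier by (simp add: y_def K.m_assoc)
    also have "\<dots> = d"
      using d inv aK R_carrier by (simp add: K.m_assoc[symmetric])
    finally show ?thesis using d by simp
  qed
  let ?Q = "{u \<oplus> y \<otimes> v | u v. u \<in> P \<and> v \<in> P}"
  have Q: "ideal ?Q D" "P \<subseteq> ?Q" using scaled_sum_ideal[OF Pi yK yP] by auto
  have "?Q \<noteq> P"
  proof
    assume eq: "?Q = P"
    have "y \<otimes> x \<in> P" if "x \<in> P" for x
      using scaled_sum_ideal(3)[OF Pi yK yP that] eq by simp
    then show False using stabilizer_of_ideal_integral[OF yK Pi] assms yR by blast
  qed
  then have "?Q = R"
    using maximalideal.I_maximal[OF prime_maximal[OF assms]] Q idealD(1)[OF Q(1)] by blast
  then have "\<one> \<in> ?Q" using R_closed(2) by blast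
  then obtain p q where "p \<in> P" "q \<in> P" "p \<oplus> y \<otimes> q = \<one>" by force
  then show ?thesis using that yK yR yP by blast
qed

text \<open>Every proper ideal \<open>J\<close> above \<open>I\<close> lies below one of the finitely many primes \<open>P\<close> above \<open>I\<close>. For a fixed \<open>P\<close>,
  the map \<open>J \<mapsto> J + yJ\<close> embeds the ideals between \<open>I\<close> and \<open>P\<close> into the ideals above \<open>I + yI\<close>, which are
  finite in number by the induction hypothesis.\<close>

lemma finite_ideals_above:
  assumes "ideal I D" "I \<noteq> {\<zero>}"
  shows "finite {J. ideal J D \<and> I \<subseteq> J}"
  using assms
proof (induction rule: D.ideal_induct)
  case (step I)
  note I = \<open>ideal I D\<close> \<open>I \<noteq> {\<zero>}\<close>
  have below: "finite {J. ideal J D \<and> I \<subseteq> J \<and> J \<subseteq> P}" (is "finite ?A")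
    if P: "primeideal P D" "I \<subseteq> P" for P
  proof -
    have Pi: "ideal P D" using P primeideal.axioms(1) by blast
    have "P \<noteq> {\<zero>}" using I P(2) idealD(3)[OF I(1)] by blast
    then obtain y p q where y: "y \<in> carrier K" "y \<notin> R" and yP: "\<And>x. x \<in> P \<Longrightarrow> y \<otimes> x \<in> R"
      and pq: "p \<in> P" "q \<in> P" "p \<oplus> y \<otimes> q = \<one>"
      using prime_invertible[OF P(1)] by metis
    define f where "f J = {u \<oplus> y \<otimes> v | u v. u \<in> J \<and> v \<in> J}" for J
    have f: "ideal (f J) D" "J \<subseteq> f J" "\<And>x. x \<in> J \<Longrightarrow> y \<otimes> x \<in> f J"
      if "ideal J D" "J \<subseteq> P" for J
    proof -
      have "\<And>x. x \<in> J \<Longrightarrow> y \<otimes> x \<in> R" using yP that(2) by blast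
      from scaled_sum_ideal[OF that(1) y(1) this]
      show "ideal (f J) D" "J \<subseteq> f J" "\<And>x. x \<in> J \<Longrightarrow> y \<otimes> x \<in> f J"
        unfolding f_def by blast+
    qed
    have "f I \<noteq> I"
      using stabilizer_of_ideal_integral[OF y(1) I] f(3)[OF I(1) P(2)] y(2) by blast
    then have "I \<subset> f I" using f(2)[OF I(1) P(2)] by blast
    moreover from this have "f I \<noteq> {\<zero>}" using I(2) idealD(3)[OF I(1)] by blast
    ultimately have fin: "finite {J. ideal J D \<and> f I \<subseteq> J}"
      using step.IH[OF f(1)[OF I(1) P(2)]] by blast
    \<comment> \<open>Injectivity: \<open>P (J + yJ) = (P + yP) J = J\<close>, so \<open>J\<close> can be recovered from its image.\<close>
    have recover: "J \<subseteq> J'" if J: "ideal J D" "J \<subseteq> P" and J': "ideal J' D" "J' \<subseteq> P"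
      and eq: "f J = f J'" for J J'
    proof
      fix z assume z: "z \<in> J"
      have zK: "z \<in> carrier K" using z J(1) idealD by blast
      have into: "w \<otimes> t \<in> J'" if w: "w \<in> P" and t: "t \<in> f J" for w t
      proof -
        have "t \<in> f J'" using t eq by simp
        then obtain u v where uv: "t = u \<oplus> y \<otimes> v" "u \<in> J'" "v \<in> J'"
          unfolding f_def by blast
        have "w \<otimes> t = w \<otimes> u \<oplus> (y \<otimes> w) \<otimes> v"
          using uv y(1) idealD(2)[OF J'(1) uv(2)] idealD(2)[OF J'(1) uv(3)] idealD(2)[OF Pi w]
          by simp algebra
        then show ?thesis
          using idealD(4)[OF J'(1) idealD(5)[OF J'(1) uv(2) idealD(1)[OF Pi w]]
              idealD(5)[OF J'(1) uv(3) yP[OF w]]] by simp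
      qed
      have "z = (p \<oplus> y \<otimes> q) \<otimes> z" using pq(3) zK by simp
      also have "\<dots> = p \<otimes> z \<oplus> q \<otimes> (y \<otimes> z)"
        using zK y(1) idealD(2)[OF Pi pq(1)] idealD(2)[OF Pi pq(2)] by algebra
      finally have "z = p \<otimes> z \<oplus> q \<otimes> (y \<otimes> z)" .
      moreover have "p \<otimes> z \<in> J'" "q \<otimes> (y \<otimes> z) \<in> J'"
        using into pq f(2,3)[OF J] z by blast+
      ultimately show "z \<in> J'" using idealD(4)[OF J'(1)] by metis
    qed
    have "inj_on f ?A"
    proof (rule inj_onI)
      fix J J' assume "J \<in> ?A" "J' \<in> ?A" "f J = f J'"
      then show "J = J'" using recover[of J J'] recover[of J' J] by auto
    qed
    moreover have "f ` ?A \<subseteq> {J. ideal J D \<and> f I \<subseteq> J}"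
    proof (rule image_subsetI)
      fix J assume J: "J \<in> ?A"
      then have "f I \<subseteq> f J" unfolding f_def by blast
      then show "f J \<in> {J. ideal J D \<and> f I \<subseteq> J}" using J f(1) by blast
    qed
    ultimately show ?thesis using fin by (rule inj_on_finite)
  qed
  have "{J. ideal J D \<and> I \<subseteq> J} \<subseteq> insert R
      (\<Union>P\<in>{P. primeideal P D \<and> I \<subseteq> P}. {J. ideal J D \<and> I \<subseteq> J \<and> J \<subseteq> P})" (is "_ \<subseteq> ?U")
  proof
    fix J assume "J \<in> {J. ideal J D \<and> I \<subseteq> J}"
    then have J: "ideal J D" "I \<subseteq> J" by simp_all
    show "J \<in> ?U"
    proof (cases "J = R")
      case False
      then obtain P where "primeideal P D" "J \<subseteq> P"
        using proper_ideal_in_prime[OF J(1)] by metis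
      moreover from this have "I \<subseteq> P" using J(2) by simp
      ultimately show ?thesis using J by auto
    qed simp
  qed
  moreover have "finite \<dots>"
    using finite_primes_above[OF I] below by simp
  ultimately show ?case by (rule finite_subset)
qed

lemma finite_ideals_containing:
  assumes "x \<in> R" "x \<noteq> \<zero>"
  shows "finite {J. ideal J D \<and> x \<in> J}"
proof -
  have "PIdl\<^bsub>D\<^esub> x \<noteq> {\<zero>}" using D.cgenideal_self[OF assms(1)] assms(2) by auto
  then have "finite {J. ideal J D \<and> PIdl\<^bsub>D\<^esub> x \<subseteq> J}"
    using finite_ideals_above D.cgenideal_ideal[OF assms(1)] by blast
  moreover have "{J. ideal J D \<and> x \<in> J} \<subseteq> {J. ideal J D \<and> PIdl\<^bsub>D\<^esub> x \<subseteq> J}"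
    using D.cgenideal_minimal by blast
  ultimately show ?thesis by (rule rev_finite_subset)
qed

lemma quotient_ideal_integral:
  assumes I: "ideal I D" and J: "ideal J D" and "I \<subseteq> J"
  shows "ideal (I \<cdot>\<^bsub>K\<^esub> ideal_inverse D K J) D"
  unfolding ideal_iff
proof (intro conjI ballI)
  let ?Q = "I \<cdot>\<^bsub>K\<^esub> ideal_inverse D K J"
  have inv: "j \<in> carrier K" "i \<otimes> j \<in> R" if "i \<in> I" "j \<in> ideal_inverse D K J" for i j
  proof -
    show "j \<in> carrier K" using that by (simp add: ideal_inverse_def)
    then have "i \<otimes> j = j \<otimes> i" using idealD(2)[OF I that(1)] K.m_comm by blast
    then show "i \<otimes> j \<in> R" using that \<open>I \<subseteq> J\<close> by (auto simp: ideal_inverse_def)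
  qed
  show sub: "?Q \<subseteq> R"
  proof
    fix x assume "x \<in> ?Q" then show "x \<in> R"
      by induction (auto intro: inv R_closed)
  qed
  have "\<zero> \<in> ideal_inverse D K J"
    using idealD(2)[OF J] R_closed(1) by (simp add: ideal_inverse_def)
  from ideal_prod.prod[OF idealD(3)[OF I] this, of K]
  show "\<zero> \<in> ?Q" by simp
  show "x \<oplus> y \<in> ?Q" if "x \<in> ?Q" "y \<in> ?Q" for x y
    using that by (rule ideal_prod.sum)
  show "d \<otimes> x \<in> ?Q" if "x \<in> ?Q" and d: "d \<in> R" for x d
    using that(1)
  proof induction
    case (prod i j)
    then have "d \<otimes> (i \<otimes> j) = (d \<otimes> i) \<otimes> j"
      using idealD(2)[OF I] inv R_carrier[OF d] by (simp add: K.m_assoc)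
    then show ?case
      using ideal_prod.prod[OF idealD(5)[OF I prod(1) d] prod(2), of K] by simp
  next
    case (sum s t)
    then have "d \<otimes> (s \<oplus> t) = d \<otimes> s \<oplus> d \<otimes> t"
      using sub R_carrier d by (simp add: K.r_distr subset_iff)
    then show ?case using sum.IH ideal_prod.sum[of "d \<otimes> s" K] by simp
  qed
qed

end


section \<open>Powers and products of ideals\<close>

lemma ideal_prod_mono: "I \<subseteq> I' \<Longrightarrow> J \<subseteq> J' \<Longrightarrow> I \<cdot>\<^bsub>R\<^esub> J \<subseteq> I' \<cdot>\<^bsub>R\<^esub> J'"
proof
  fix x assume "I \<subseteq> I'" "J \<subseteq> J'" "x \<in> I \<cdot>\<^bsub>R\<^esub> J"
  from this(3,1,2) show "x \<in> I' \<cdot>\<^bsub>R\<^esub> J'"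
    by induction (auto intro: ideal_prod.intros)
qed

context cring
begin

interpretation ideals: comm_monoid "ideals_set R"
  by (rule ideals_set_is_comm_monoid)

lemma ideals_set_simps:
  "carrier (ideals_set R) = {I. ideal I R}" "\<one>\<^bsub>ideals_set R\<^esub> = carrier R"
  "I \<otimes>\<^bsub>ideals_set R\<^esub> J = I \<cdot> J"
  by (simp_all add: ideals_set_def)

lemma ideal_pow_is_ideal: "ideal b R \<Longrightarrow> ideal (b [^]\<^bsub>ideals_set R\<^esub> (k::nat)) R"
  using ideals.nat_pow_closed[of b k] by (simp add: ideals_set_simps)

lemma ideal_pow_antimono:
  assumes b: "ideal b R" and "k \<le> l"
  shows "b [^]\<^bsub>ideals_set R\<^esub> (l::nat) \<subseteq> b [^]\<^bsub>ideals_set R\<^esub> k"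
proof (rule lift_Suc_antimono_le[of "\<lambda>k. b [^]\<^bsub>ideals_set R\<^esub> k", OF _ \<open>k \<le> l\<close>])
  show "b [^]\<^bsub>ideals_set R\<^esub> Suc n \<subseteq> b [^]\<^bsub>ideals_set R\<^esub> n" for n
    using ideal_prod_inter[OF ideal_pow_is_ideal[OF b] b] by (simp add: ideals_set_simps)
qed

lemma ideal_epow_is_ideal: "ideal b R \<Longrightarrow> ideal (ideal_epow R b e) R"
  by (cases e) (auto simp: ideal_epow_def ideal_pow_is_ideal oneideal zeroideal)

lemma ideal_epow_0 [simp]: "ideal_epow R b 0 = carrier R"
  by (simp add: ideal_epow_def zero_enat_def ideals_set_simps)

lemma ideal_epow_antimono:
  assumes b: "ideal b R" and "e \<le> e'"
  shows "ideal_epow R b e' \<subseteq> ideal_epow R b e"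
proof (cases e')
  case (enat l)
  then obtain k where "e = enat k" "k \<le> l" using \<open>e \<le> e'\<close> by (cases e) auto
  then show ?thesis using enat ideal_pow_antimono[OF b] by (simp add: ideal_epow_def)
next
  case infinity
  have "{\<zero>} \<subseteq> ideal_epow R b e"
    using ideal_epow_is_ideal[OF b] additive_subgroup.zero_closed ideal.axioms(1) by fast
  moreover have "ideal_epow R (carrier R) e = carrier R"
    using ideals.nat_pow_one by (cases e) (simp_all add: ideal_epow_def ideals_set_simps)
  moreover have "ideal_epow R b e' = (if b = carrier R then carrier R else {\<zero>})"
    using infinity by (simp add: ideal_epow_def)
  ultimately show ?thesis by (cases "b = carrier R") simp_all
qed

lemma finprod_ideals_is_ideal:
  "(\<And>i. i \<in> A \<Longrightarrow> ideal (f i) R) \<Longrightarrow> ideal (finprod (ideals_set R) f A) R"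
  using ideals.finprod_closed[of f A] by (auto simp: ideals_set_simps Pi_iff)

lemma finprod_ideals_mono:
  assumes "finite A" and "\<And>i. i \<in> A \<Longrightarrow> ideal (f i) R" "\<And>i. i \<in> A \<Longrightarrow> ideal (g i) R"
    and "\<And>i. i \<in> A \<Longrightarrow> f i \<subseteq> g i"
  shows "finprod (ideals_set R) f A \<subseteq> finprod (ideals_set R) g A"
  using assms
proof (induction A)
  case (insert a A)
  then have "f \<in> A \<rightarrow> carrier (ideals_set R)" "g \<in> A \<rightarrow> carrier (ideals_set R)"
    "f a \<in> carrier (ideals_set R)" "g a \<in> carrier (ideals_set R)"
    by (auto simp: ideals_set_simps)
  then show ?case
    using insert by (simp add: ideals.finprod_insert ideals_set_simps(3) ideal_prod_mono)
qed simp

text \<open>Finiteness of the nontrivial factors \<open>f i\<close> passes to the \<open>g i\<close>, since \<open>f i \<subseteq> g i\<close> makes \<open>g i\<close> the unit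
  ideal whenever \<open>f i\<close> is.\<close>

lemma finprod_nontrivial_ideals_mono:
  assumes fin: "finite {i \<in> T. f i \<noteq> carrier R}"
    and f: "\<And>i. i \<in> T \<Longrightarrow> ideal (f i) R" and g: "\<And>i. i \<in> T \<Longrightarrow> ideal (g i) R"
    and le: "\<And>i. i \<in> T \<Longrightarrow> f i \<subseteq> g i"
  shows "finprod (ideals_set R) f {i \<in> T. f i \<noteq> carrier R}
    \<subseteq> finprod (ideals_set R) g {i \<in> T. g i \<noteq> carrier R}" (is "_ \<subseteq> finprod _ g ?B")
proof -
  let ?A = "{i \<in> T. f i \<noteq> carrier R}"
  have "?B \<subseteq> ?A"
    using le g ideal.Icarr by fast
  then have "finprod (ideals_set R) g ?B = finprod (ideals_set R) g ?A"
    by (intro ideals.finprod_mono_neutral_cong_left[OF fin]) (auto simp: ideals_set_simps g)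
  then show ?thesis
    using finprod_ideals_mono[OF fin, of f g] f g le by simp
qed

end


section \<open>Removed orderings and their exponents\<close>

lemma finite_subsets_of_card: "finite {A. A \<subseteq> {..<n::nat} \<and> card A = k}"
  by (rule finite_subset[of _ "Pow {..<n}"]) auto

lemma subsets_of_card_nonempty: "{A. A \<subseteq> {..<n::nat} \<and> card A = n - r} \<noteq> {}"
proof -
  have "{..<n - r} \<subseteq> {..<n} \<and> card {..<n - r} = n - r" by auto
  then show ?thesis by blast
qed

lemma removed_sum_le:
  "A \<subseteq> {..<n} \<Longrightarrow> card A = n - r \<Longrightarrow>
   removed_sum D h r b a n s \<le> (\<Sum>i\<in>A. min h (ideal_val D b (s \<ominus>\<^bsub>D\<^esub> a i)))"
  unfolding removed_sum_def by (rule Min_le) (auto simp: finite_subsets_of_card)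

lemma removed_sum_attained:
  obtains A where "A \<subseteq> {..<n}" "card A = n - r"
    "removed_sum D h r b a n s = (\<Sum>i\<in>A. min h (ideal_val D b (s \<ominus>\<^bsub>D\<^esub> a i)))"
proof -
  let ?F = "(\<lambda>A. \<Sum>i\<in>A. min h (ideal_val D b (s \<ominus>\<^bsub>D\<^esub> a i))) ` {A. A \<subseteq> {..<n} \<and> card A = n - r}"
  have "Min ?F \<in> ?F"
    by (rule Min_in) (use finite_subsets_of_card subsets_of_card_nonempty in auto)
  then show ?thesis
    using that unfolding removed_sum_def by blast
qed

lemma removed_sum_eq_0:
  assumes "n \<le> r"
  shows "removed_sum D h r b a n s = 0"
  using removed_sum_le[of "{}" n r D h b a s] assms by simp

text \<open>From an index set of size \<open>n + 1 - r\<close> in \<open>{0, \<dots>, n}\<close>, dropping \<open>n\<close> if it occurs and any index otherwise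
  leaves an admissible index set for \<open>n\<close> with a smaller sum.\<close>

lemma removed_sum_mono_Suc: "removed_sum D h r b a n s \<le> removed_sum D h r b a (Suc n) s"
proof (cases "n < r")
  case True
  then show ?thesis by (simp add: removed_sum_eq_0)
next
  case False
  obtain A where A: "A \<subseteq> {..<Suc n}" "card A = Suc n - r"
    "removed_sum D h r b a (Suc n) s = (\<Sum>i\<in>A. min h (ideal_val D b (s \<ominus>\<^bsub>D\<^esub> a i)))"
    by (rule removed_sum_attained)
  have fin: "finite A" using A(1) finite_subset by blast
  have "A \<noteq> {}" using A(2) False by auto
  then obtain x where x: "x \<in> A" "n \<in> A \<longrightarrow> x = n" by blast
  have "A - {x} \<subseteq> {..<n}"
    using A(1) x(2) by (auto simp: less_Suc_eq)
  moreover have "card (A - {x}) = n - r"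
    using A(2) x(1) fin False by simp
  ultimately have "removed_sum D h r b a n s \<le> (\<Sum>i\<in>A - {x}. min h (ideal_val D b (s \<ominus>\<^bsub>D\<^esub> a i)))"
    by (rule removed_sum_le)
  also have "\<dots> \<le> removed_sum D h r b a (Suc n) s"
    unfolding A(3) using fin by (intro sum_mono2) auto
  finally show ?thesis .
qed

lemma removed_sum_cong:
  assumes "\<And>i. i < n \<Longrightarrow> a i = a' i"
  shows "removed_sum D h r b a n s = removed_sum D h r b a' n s"
  unfolding removed_sum_def
  by (intro arg_cong[where f = Min] image_cong refl sum.cong) (use assms in auto)

text \<open>The removed sum at \<open>n\<close> depends on the earlier entries only (\<open>removed_sum_cong\<close>), so the minimizing
  elements can be chosen one after the other.\<close>

lemma removed_ordering_exists:
  assumes "S \<noteq> {}"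
  shows "\<exists>a. removed_ordering D h r S b a"
proof -
  have "\<exists>a. \<forall>n. a n \<in> S \<and> (\<forall>s\<in>S. removed_sum D h r b a n (a n) \<le> removed_sum D h r b a n s)"
  proof (rule dependent_wellorder_choice)
    fix s n and f g :: "nat \<Rightarrow> 'a" assume "\<And>m. m < n \<Longrightarrow> f m = g m"
    then show "(s \<in> S \<and> (\<forall>t\<in>S. removed_sum D h r b f n s \<le> removed_sum D h r b f n t)) =
        (s \<in> S \<and> (\<forall>t\<in>S. removed_sum D h r b g n s \<le> removed_sum D h r b g n t))"
      using removed_sum_cong[of n f g D] by simp
  next
    fix n f
    let ?P = "\<lambda>v. \<exists>s\<in>S. v = removed_sum D h r b f n s"
    have "\<exists>v. ?P v" using assms by blast
    then have "?P (LEAST v. ?P v)" by (rule LeastI_ex)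
    then obtain s where "s \<in> S" "(LEAST v. ?P v) = removed_sum D h r b f n s" by blast
    moreover have "(LEAST v. ?P v) \<le> removed_sum D h r b f n t" if "t \<in> S" for t
      using that by (intro Least_le) blast
    ultimately show "\<exists>s. s \<in> S \<and> (\<forall>t\<in>S. removed_sum D h r b f n s \<le> removed_sum D h r b f n t)"
      by metis
  qed
  then show ?thesis
    unfolding removed_ordering_def alpha_seq_def by blast
qed

text \<open>One ordering serves for all \<open>n\<close>, which makes exponents at different \<open>n\<close> comparable. For \<open>n \<le> r\<close> the
  minimality holds because the removed sums vanish.\<close>

lemma ordering_for_alpha:
  assumes "S \<noteq> {}"
  obtains a where "range a \<subseteq> S" "\<And>n. alpha D h r S b n = removed_sum D h r b a n (a n)"
    "\<And>n s. s \<in> S \<Longrightarrow> alpha D h r S b n \<le> removed_sum D h r b a n s"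
proof -
  define a where "a = (SOME a. removed_ordering D h r S b a)"
  have "removed_ordering D h r S b a"
    unfolding a_def by (rule someI_ex[OF removed_ordering_exists[OF assms]])
  moreover have eq: "alpha D h r S b n = removed_sum D h r b a n (a n)" for n
    by (simp add: alpha_def alpha_seq_def a_def)
  ultimately have "range a \<subseteq> S"
    and le: "n > r \<Longrightarrow> s \<in> S \<Longrightarrow> alpha D h r S b n \<le> removed_sum D h r b a n s" for n s
    by (auto simp: removed_ordering_def alpha_seq_def)
  then show ?thesis
    using that[of a] eq le removed_sum_eq_0[of _ r] by (metis not_less order_refl)
qed

lemma alpha_mono_Suc:
  assumes "S \<noteq> {}"
  shows "alpha D h r S b n \<le> alpha D h r S b (Suc n)"
proof -
  obtain a where a: "range a \<subseteq> S" "\<And>n. alpha D h r S b n = removed_sum D h r b a n (a n)"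
    "\<And>n s. s \<in> S \<Longrightarrow> alpha D h r S b n \<le> removed_sum D h r b a n s"
    using ordering_for_alpha[OF assms] by blast
  have "alpha D h r S b n \<le> removed_sum D h r b a n (a (Suc n))"
    using a(1,3) by blast
  also have "\<dots> \<le> removed_sum D h r b a (Suc n) (a (Suc n))"
    by (rule removed_sum_mono_Suc)
  finally show ?thesis by (simp add: a(2))
qed

lemma (in cring) ideal_val_eq_0:
  assumes b: "ideal b R" and x: "x \<in> carrier R" "x \<notin> b"
  shows "ideal_val R b x = 0"
proof -
  have "k = 0" if "PIdl x \<subseteq> b [^]\<^bsub>ideals_set R\<^esub> k" for k :: nat
  proof (rule ccontr)
    assume "k \<noteq> 0"
    then obtain j where "k = Suc j" by (cases k) auto
    then have "b [^]\<^bsub>ideals_set R\<^esub> k \<subseteq> b"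
      using ideal_prod_inter[OF ideal_pow_is_ideal[OF b] b] by (simp add: ideals_set_simps)
    then show False using that cgenideal_self[OF x(1)] x(2) by blast
  qed
  then have "ideal_val R b x \<le> 0"
    unfolding ideal_val_def by (intro Sup_least) (auto simp: zero_enat_def)
  then show ?thesis by simp
qed

text \<open>Each entry \<open>a i\<close> is congruent modulo \<open>b\<close> to at most one element of \<open>S0\<close>, so the \<open>n\<close> entries cannot
  account for all of the more than \<open>n\<close> elements. An element congruent to none of them has removed sum zero.\<close>

lemma (in cring) alpha_eq_0:
  assumes b: "ideal b R" and S: "S \<subseteq> carrier R"
    and S0: "S0 \<subseteq> S" "finite S0" "n < card S0"
    and sep: "\<And>s t. s \<in> S0 \<Longrightarrow> t \<in> S0 \<Longrightarrow> s \<noteq> t \<Longrightarrow> s \<ominus> t \<notin> b"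
  shows "alpha R h r S b n = 0"
proof -
  have "S \<noteq> {}" using S0 by auto
  then obtain a where a: "range a \<subseteq> S"
    "\<And>n s. s \<in> S \<Longrightarrow> alpha R h r S b n \<le> removed_sum R h r b a n s"
    using ordering_for_alpha[of S R h r b] by metis
  have carr: "a i \<in> carrier R" for i using a(1) S by blast
  have "\<exists>s\<in>S0. \<forall>i<n. s \<ominus> a i \<notin> b"
  proof (rule ccontr)
    assume "\<not> (\<exists>s\<in>S0. \<forall>i<n. s \<ominus> a i \<notin> b)"
    then obtain c where c: "\<And>s. s \<in> S0 \<Longrightarrow> c s < n \<and> s \<ominus> a (c s) \<in> b" by metis
    \<comment> \<open>\<open>c s\<close> is the index of an entry congruent to \<open>s\<close>; it determines \<open>s\<close>.\<close>
    have "inj_on c S0"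
    proof (rule inj_onI)
      fix s t assume st: "s \<in> S0" "t \<in> S0" "c s = c t"
      have "s \<in> carrier R" "t \<in> carrier R" using st S0(1) S by auto
      then have "s \<ominus> t = (s \<ominus> a (c s)) \<ominus> (t \<ominus> a (c s))"
        using carr[of "c s"] by algebra
      moreover have "\<dots> \<in> b"
        using c st ideal.axioms(1)[OF b]
        by (metis additive_subgroup.a_closed additive_subgroup.a_inv_closed a_minus_def)
      ultimately show "s = t" using sep st by metis
    qed
    then have "card S0 \<le> card {..<n}"
      by (rule card_inj_on_le) (use c in auto)
    then show False using S0(3) by simp
  qed
  then obtain s where s: "s \<in> S0" "\<And>i. i < n \<Longrightarrow> s \<ominus> a i \<notin> b" by blast
  have "alpha R h r S b n \<le> removed_sum R h r b a n s" using a(2) s S0 by blast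
  also have "\<dots> \<le> (\<Sum>i\<in>{..<n - r}. min h (ideal_val R b (s \<ominus> a i)))"
    by (rule removed_sum_le) auto
  also have "\<dots> = 0"
    using s S0 S carr by (intro sum.neutral) (auto simp: ideal_val_eq_0[OF b])
  finally show ?thesis by simp
qed

text \<open>For \<open>n < |S|\<close> a nontrivial factor comes from an ideal containing a difference of two of \<open>n + 1\<close> fixed
  distinct elements of \<open>S\<close>.\<close>

lemma (in dedekind) finite_nontrivial_factors:
  assumes S: "S \<subseteq> carrier D" and T: "T \<subseteq> {b. ideal b D}" and n: "infinite S \<or> n < card S"
  shows "finite {b \<in> T. ideal_epow D b (alpha D h r S b n) \<noteq> carrier D}"
proof -
  obtain S0 where S0: "S0 \<subseteq> S" "finite S0" "n < card S0"
  proof (cases "finite S")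
    case True
    then show ?thesis using that n by blast
  next
    case False
    then obtain S0 where "S0 \<subseteq> S" "finite S0" "card S0 = Suc n"
      using infinite_arbitrarily_large by blast
    then show ?thesis using that by simp
  qed
  let ?X = "{s \<ominus>\<^bsub>D\<^esub> t | s t. s \<in> S0 \<and> t \<in> S0 \<and> s \<noteq> t}"
  have "?X = (\<lambda>(s, t). s \<ominus>\<^bsub>D\<^esub> t) ` {(s, t). s \<in> S0 \<and> t \<in> S0 \<and> s \<noteq> t}" by auto
  moreover have "finite {(s, t). s \<in> S0 \<and> t \<in> S0 \<and> s \<noteq> t}"
    by (rule finite_subset[of _ "S0 \<times> S0"]) (use S0 in auto)
  ultimately have "finite ?X" by simp
  moreover have "finite {b. ideal b D \<and> x \<in> b}" if "x \<in> ?X" for x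
  proof (rule finite_ideals_containing)
    obtain s t where st: "x = s \<ominus>\<^bsub>D\<^esub> t" "s \<in> carrier D" "t \<in> carrier D" "s \<noteq> t"
      using \<open>x \<in> ?X\<close> S0(1) S by blast
    then show "x \<in> carrier D" by simp
    show "x \<noteq> \<zero>" using st D.r_right_minus_eq by simp
  qed
  ultimately have "finite (\<Union>x\<in>?X. {b. ideal b D \<and> x \<in> b})" by blast
  moreover have "{b \<in> T. ideal_epow D b (alpha D h r S b n) \<noteq> carrier D}
      \<subseteq> (\<Union>x\<in>?X. {b. ideal b D \<and> x \<in> b})"
  proof
    fix b assume b: "b \<in> {b \<in> T. ideal_epow D b (alpha D h r S b n) \<noteq> carrier D}"
    then have "ideal b D" using T by blast
    have "alpha D h r S b n \<noteq> 0" using b by force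
    then obtain s t where "s \<in> S0" "t \<in> S0" "s \<noteq> t" "s \<ominus>\<^bsub>D\<^esub> t \<in> b"
      using D.alpha_eq_0[OF \<open>ideal b D\<close> S S0] by metis
    then show "b \<in> (\<Union>x\<in>?X. {b. ideal b D \<and> x \<in> b})" using \<open>ideal b D\<close> by blast
  qed
  ultimately show ?thesis by (rule rev_finite_subset)
qed


section \<open>Integrality of the generalized-integer ideals\<close>

theorem theorem3p11:
  fixes D K :: "('a, 'm) ring_scheme"
    and S :: "'a set" and h :: enat and r n :: nat and T :: "'a set set"
  assumes "dedekind_domain D K"
    and "S \<subseteq> carrier D" and "S \<noteq> {}"
    and "T \<subseteq> {b. ideal b D}"
    and "n \<ge> 1" and "infinite S \<or> n < card S"
  shows "ideal (gen_integer D K h r S T n) D"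
proof -
  interpret dedekind D K by unfold_locales (rule assms(1))
  have T: "\<And>b. b \<in> T \<Longrightarrow> ideal b D" using assms(4) by blast
  obtain m where m: "n = Suc m" using assms(5) by (cases n) auto
  have ideals: "ideal (gen_factorial D h r S T k) D" for k
    unfolding gen_factorial_def
    by (rule D.finprod_ideals_is_ideal) (simp add: D.ideal_epow_is_ideal T)
  have "gen_factorial D h r S T n \<subseteq> gen_factorial D h r S T (n - 1)"
    unfolding gen_factorial_def
  proof (rule D.finprod_nontrivial_ideals_mono)
    show "finite {b \<in> T. ideal_epow D b (alpha D h r S b n) \<noteq> carrier D}"
      using finite_nontrivial_factors assms(2,4,6) by blast
    show "ideal_epow D b (alpha D h r S b n) \<subseteq> ideal_epow D b (alpha D h r S b (n - 1))"
      if "b \<in> T" for b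
      using D.ideal_epow_antimono[OF T[OF that]] alpha_mono_Suc[OF assms(3), of D h r b m] by (simp add: m)
  qed (simp_all add: D.ideal_epow_is_ideal T)
  then show ?thesis
    unfolding gen_integer_def by (intro quotient_ideal_integral ideals)
qed

end
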